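(* Let $\mathbb{F}$ be a field and let $\mathbf{L}=\mathbf{L}_0\oplus\mathbf{W}$ be an almost Abelian Lie algebra over $\mathbb{F}$, where $\mathbf{L}_0$ is an indecomposable almost Abelian Lie algebra and $\mathbf{W}$ is a possibly trivial Abelian Lie algebra. Then the algebra of derivations of $\mathbf{L}$ is $$\mathrm{Der}(\mathbf{L})=\left\{\begin{pmatrix}\phi_{00}&\phi_{01}\\ \phi_{10}&\phi_{11}\end{pmatrix}\in\mathrm{End}_{\mathbb{F}}(\mathbf{L})\;\middle|\;\phi_{00}\in\mathrm{Der}(\mathbf{L}_0),\ \phi_{01}\mathbf{W}\subset\mathcal{Z}(\mathbf{L}_0),\ [\mathbf{L}_0,\mathbf{L}_0]\subset\ker\phi_{10}\right\}.$$
   Context: An almost Abelian Lie algebra over a field $\mathbb{F}$ (of arbitrary, possibly infinite, dimension) is a non-Abelian Lie algebra that contains a codimension 1 Abelian subalgebra. A Lie algebra is decomposable if it is the direct sum of two commuting nonzero Lie subalgebras; otherwise it is indecomposable. Here $\mathbf{L}_0\oplus\mathbf{W}$ is the Lie algebra direct sum. $\mathcal{Z}(\cdot)$ denotes the centre. The block form of a linear map $\phi:\mathbf{L}\to\mathbf{L}$ is with respect to $\mathbf{L}=\mathbf{L}_0\oplus\mathbf{W}$: $\phi(X+Y)=(\phi_{00}X+\phi_{01}Y)+(\phi_{10}X+\phi_{11}Y)$ for $X\in\mathbf{L}_0$, $Y\in\mathbf{W}$, with linear maps $\phi_{00}:\mathbf{L}_0\to\mathbf{L}_0$, $\phi_{01}:\mathbf{W}\to\mathbf{L}_0$,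 $\phi_{10}:\mathbf{L}_0\to\mathbf{W}$, $\phi_{11}:\mathbf{W}\to\mathbf{W}$. *)

theory Defs
  imports "HOL-Analysis.Product_Vector"
begin

locale lie_algebra = vector_space scale
  for scale :: "'f::field \<Rightarrow> 'a::ab_group_add \<Rightarrow> 'a" +
  fixes bracket :: "'a \<Rightarrow> 'a \<Rightarrow> 'a"
  assumes linear_bracket_left: "Vector_Spaces.linear scale scale (\<lambda>x. bracket x y)"
    and linear_bracket_right: "Vector_Spaces.linear scale scale (\<lambda>y. bracket x y)"
    and bracket_self: "bracket x x = 0"
    and jacobi: "bracket x (bracket y z) + bracket y (bracket z x) + bracket z (bracket x y) = 0"
begin

definition subalgebra :: "'a set \<Rightarrow> bool" where
  "subalgebra A \<longleftrightarrow> subspace A \<and> (\<forall>x\<in>A. \<forall>y\<in>A. bracket x y \<in> A)"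

definition commuting :: "'a set \<Rightarrow> 'a set \<Rightarrow> bool" where
  "commuting A B \<longleftrightarrow> (\<forall>x\<in>A. \<forall>y\<in>B. bracket x y = 0)"

definition abelian :: "'a set \<Rightarrow> bool" where
  "abelian A \<longleftrightarrow> commuting A A"

text \<open>The whole space is the internal direct sum, as a vector space, of A and B.\<close>

definition is_direct_sum :: "'a set \<Rightarrow> 'a set \<Rightarrow> bool" where
  "is_direct_sum A B \<longleftrightarrow>
     subspace A \<and> subspace B \<and> A \<inter> B = {0} \<and> {a + b |a b. a \<in> A \<and> b \<in> B} = UNIV"

text \<open>The codimension is the dimension of a complement. Since \<^term>\<open>dim\<close> is 0 on
  infinite-dimensional subspaces, dimension 1 has its usual meaning without any finiteness
  assumption on the whole space.\<close>

definition codimension_one :: "'a set \<Rightarrow> bool" where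
  "codimension_one A \<longleftrightarrow> (\<exists>C. is_direct_sum A C \<and> dim C = 1)"

definition almost_abelian :: bool where
  "almost_abelian \<longleftrightarrow>
     \<not> abelian UNIV \<and> (\<exists>A. subalgebra A \<and> abelian A \<and> codimension_one A)"

definition decomposable :: bool where
  "decomposable \<longleftrightarrow>
     (\<exists>A B. subalgebra A \<and> subalgebra B \<and> A \<noteq> {0} \<and> B \<noteq> {0} \<and>
            commuting A B \<and> is_direct_sum A B)"

definition indecomposable :: bool where
  "indecomposable \<longleftrightarrow> \<not> decomposable"

definition center :: "'a set" where
  "center = {z. \<forall>x. bracket z x = 0}"

definition derived_algebra :: "'a set" where
  "derived_algebra = span {bracket x y |x y. True}"

definition derivations :: "('a \<Rightarrow> 'a) set" where
  "derivations = {D. Vector_Spaces.linear scale scale D \<and>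
     (\<forall>x y. D (bracket x y) = bracket (D x) y + bracket x (D y))}"

end

text \<open>The Lie algebra direct sum lives on the product type, with the scalar multiplication
  \<^term>\<open>module_prod.scale\<close> and the following bracket; the two summands commute.\<close>

definition sum_bracket ::
  "('a \<Rightarrow> 'a \<Rightarrow> 'a) \<Rightarrow> ('b \<Rightarrow> 'b \<Rightarrow> 'b) \<Rightarrow> 'a \<times> 'b \<Rightarrow> 'a \<times> 'b \<Rightarrow> 'a \<times> 'b" where
  "sum_bracket br0 br1 u v = (br0 (fst u) (fst v), br1 (snd u) (snd v))"

lemma lie_algebra_direct_sum:
  assumes "lie_algebra s0 br0" "lie_algebra s1 br1"
  shows "lie_algebra (module_prod.scale s0 s1) (sum_bracket br0 br1)"
proof -
  interpret L0: lie_algebra s0 br0 by fact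
  interpret L1: lie_algebra s1 br1 by fact
  interpret P: vector_space_prod s0 s1 by unfold_locales
  note simps = sum_bracket_def P.scale_def zero_prod_def plus_prod_def
  have l0: "br0 (x + y) z = br0 x z + br0 y z" "br0 (s0 c x) z = s0 c (br0 x z)"
    "br0 z (x + y) = br0 z x + br0 z y" "br0 z (s0 c x) = s0 c (br0 z x)" for x y z c
    using L0.linear_bracket_left[of z] L0.linear_bracket_right[of z]
    by (auto simp: Vector_Spaces.linear_iff)
  have l1: "br1 (x + y) z = br1 x z + br1 y z" "br1 (s1 c x) z = s1 c (br1 x z)"
    "br1 z (x + y) = br1 z x + br1 z y" "br1 z (s1 c x) = s1 c (br1 z x)" for x y z c
    using L1.linear_bracket_left[of z] L1.linear_bracket_right[of z]
    by (auto simp: Vector_Spaces.linear_iff)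
  show ?thesis
  proof (intro lie_algebra.intro lie_algebra_axioms.intro P.p.vector_space_axioms)
    show "Vector_Spaces.linear P.scale P.scale (\<lambda>x. sum_bracket br0 br1 x y)" for y
      using P.p.vector_space_axioms by (auto simp: Vector_Spaces.linear_iff simps l0 l1)
    show "Vector_Spaces.linear P.scale P.scale (\<lambda>y. sum_bracket br0 br1 x y)" for x
      using P.p.vector_space_axioms by (auto simp: Vector_Spaces.linear_iff simps l0 l1)
  qed (simp_all add: simps L0.bracket_self L1.bracket_self L0.jacobi L1.jacobi)
qed

definition block_map ::
  "('a::plus \<Rightarrow> 'a) \<Rightarrow> ('b::plus \<Rightarrow> 'a) \<Rightarrow> ('a \<Rightarrow> 'b) \<Rightarrow> ('b \<Rightarrow> 'b) \<Rightarrow> 'a \<times> 'b \<Rightarrow> 'a \<times> 'b" where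
  "block_map \<phi>00 \<phi>01 \<phi>10 \<phi>11 = (\<lambda>(x, y). (\<phi>00 x + \<phi>01 y, \<phi>10 x + \<phi>11 y))"

end

theory Submission
  imports Defs
begin

text \<open>
  Every linear endomorphism \<open>D\<close> of \<open>L = L0 \<oplus> W\<close> has a block form, so the only question is what
  the Leibniz rule says about the four blocks. As \<open>W\<close> is Abelian, the bracket of \<open>L\<close> sees only the first components,
  and its values have second component zero:
  \<open>[(x, y), (x', y')] = ([x, x'], 0)\<close>. Hence the rule splits into
  \<open>\<phi>00 [x, x'] = [\<phi>00 x + \<phi>01 y, x'] + [x, \<phi>00 x' + \<phi>01 y']\<close> and \<open>\<phi>10 [x, x'] = 0\<close>.

  The second equation says that \<open>\<phi>10\<close> vanishes on all brackets, which for a linear map is the same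
  as vanishing on their span. In the first one, \<open>y = y' = 0\<close> gives the Leibniz rule for \<open>\<phi>00\<close>, while
  \<open>x = 0\<close> and \<open>y' = 0\<close> give \<open>[\<phi>01 y, x'] = 0\<close>, so that \<open>\<phi>01\<close> takes central values; conversely, with
  central values the terms in \<open>\<phi>01\<close> disappear and only the Leibniz rule for \<open>\<phi>00\<close> remains.
  Nothing constrains \<open>\<phi>11\<close>, as brackets neither depend on the second component nor reach it.
  The lemma \<open>block_map_Leibniz_iff\<close> carries out this comparison, and \<open>linear_prod_eq_block_map\<close>
  supplies the block form.
\<close>

lemma linear_zero:
  assumes "Vector_Spaces.linear s s' f"
  shows "f 0 = 0"
proof -
  interpret f: Vector_Spaces.linear s s' f by fact
  show ?thesis by (rule f.zero)
qed

lemma linear_block_map: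
  assumes "Vector_Spaces.linear s0 s0 \<phi>00" "Vector_Spaces.linear s1 s0 \<phi>01"
    and "Vector_Spaces.linear s0 s1 \<phi>10" "Vector_Spaces.linear s1 s1 \<phi>11"
  shows "Vector_Spaces.linear (module_prod.scale s0 s1) (module_prod.scale s0 s1)
           (block_map \<phi>00 \<phi>01 \<phi>10 \<phi>11)"
proof -
  interpret V0: vector_space s0 using assms(1) by (simp add: Vector_Spaces.linear_iff)
  interpret V1: vector_space s1 using assms(4) by (simp add: Vector_Spaces.linear_iff)
  interpret P: vector_space_prod s0 s1 by unfold_locales
  show ?thesis
    using assms P.p.vector_space_axioms
    by (simp add: Vector_Spaces.linear_iff block_map_def P.scale_def split_beta
          V0.scale_right_distrib V1.scale_right_distrib ac_simps)
qed

text \<open>The blocks are the compositions of \<open>D\<close> with the inclusions of the two summands and the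
  projections onto them; additivity on \<open>(x, y) = (x, 0) + (0, y)\<close> puts them together.\<close>

lemma linear_prod_eq_block_map:
  assumes "vector_space s0" "vector_space s1"
    and "Vector_Spaces.linear (module_prod.scale s0 s1) (module_prod.scale s0 s1) D"
  obtains \<phi>00 \<phi>01 \<phi>10 \<phi>11 where "D = block_map \<phi>00 \<phi>01 \<phi>10 \<phi>11"
    and "Vector_Spaces.linear s0 s0 \<phi>00" "Vector_Spaces.linear s1 s0 \<phi>01"
    and "Vector_Spaces.linear s0 s1 \<phi>10" "Vector_Spaces.linear s1 s1 \<phi>11"
proof -
  interpret V0: vector_space s0 by fact
  interpret V1: vector_space s1 by fact
  interpret P: vector_space_prod s0 s1 by unfold_locales
  have add: "D (u + v) = D u + D v" and scale: "D (P.scale c u) = P.scale c (D u)" for u v c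
    using assms(3) unfolding Vector_Spaces.linear_iff by blast+
  have inj: "D (x + x', 0) = D (x, 0) + D (x', 0)" "D (0, y + y') = D (0, y) + D (0, y')"
    "D (s0 c x, 0) = P.scale c (D (x, 0))" "D (0, s1 c y) = P.scale c (D (0, y))" for x x' y y' c
    using add[of "(x, 0)" "(x', 0)"] add[of "(0, y)" "(0, y')"]
      scale[of c "(x, 0)"] scale[of c "(0, y)"]
    by (simp_all add: P.scale_def)
  have split: "D (x, y) = D (x, 0) + D (0, y)" for x y
    using add[of "(x, 0)" "(0, y)"] by simp
  show thesis
  proof
    show "D = block_map (\<lambda>x. fst (D (x, 0))) (\<lambda>y. fst (D (0, y)))
        (\<lambda>x. snd (D (x, 0))) (\<lambda>y. snd (D (0, y)))"
    proof (rule ext, clarify)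
      fix x y
      show "D (x, y) = block_map (\<lambda>x. fst (D (x, 0))) (\<lambda>y. fst (D (0, y)))
          (\<lambda>x. snd (D (x, 0))) (\<lambda>y. snd (D (0, y))) (x, y)"
        using split[of x y] by (simp add: block_map_def prod_eq_iff)
    qed
  qed (simp_all add: Vector_Spaces.linear_iff assms(1,2) inj P.scale_def)
qed

context lie_algebra
begin

lemma bracket_zero [simp]: "bracket 0 x = 0" "bracket x 0 = 0"
  by (rule linear_zero[OF linear_bracket_left] linear_zero[OF linear_bracket_right])+

lemma bracket_add:
  "bracket (x + y) z = bracket x z + bracket y z"
  "bracket z (x + y) = bracket z x + bracket z y"
  using linear_bracket_left[of z] linear_bracket_right[of z]
  by (simp_all add: Vector_Spaces.linear_iff)

text \<open>The centre is defined by vanishing of left brackets; expanding \<open>[z + x, z + x] = 0\<close> gives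
  antisymmetry, which in every characteristic turns this into vanishing of right brackets.\<close>

lemma bracket_center_right:
  assumes "z \<in> center"
  shows "bracket x z = 0"
proof -
  have "bracket z x + bracket x z = 0"
    using bracket_self[of "z + x"] bracket_self[of z] bracket_self[of x]
    by (simp add: bracket_add add.commute)
  then show ?thesis
    using assms by (simp add: center_def)
qed

text \<open>A kernel is a subspace, so it contains the span of all brackets once it contains the
  brackets themselves.\<close>

lemma derived_algebra_subset_kernel_iff:
  assumes "Vector_Spaces.linear scale s \<phi>"
  shows "derived_algebra \<subseteq> {x. \<phi> x = 0} \<longleftrightarrow> (\<forall>x y. \<phi> (bracket x y) = 0)"
proof -
  interpret \<phi>: Vector_Spaces.linear scale s \<phi> by fact
  have "subspace {x. \<phi> x = 0}"
    by (rule \<phi>.subspace_kernel)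
  then have "derived_algebra \<subseteq> {x. \<phi> x = 0} \<longleftrightarrow> {bracket x y |x y. True} \<subseteq> {x. \<phi> x = 0}"
    unfolding derived_algebra_def
    by (intro iffI span_minimal) (rule subset_trans[OF span_superset])
  then show ?thesis
    by blast
qed

end

text \<open>Written out in components, the Leibniz rule mixes conditions on different blocks; setting
  single components of the two arguments to zero separates them.\<close>

lemma block_map_Leibniz_iff:
  assumes "lie_algebra s0 br0" and "\<And>y y'. br1 y y' = 0"
    and "Vector_Spaces.linear s0 s0 \<phi>00" "Vector_Spaces.linear s1 s0 \<phi>01"
    and "Vector_Spaces.linear s0 s1 \<phi>10" "Vector_Spaces.linear s1 s1 \<phi>11"
  defines "D \<equiv> block_map \<phi>00 \<phi>01 \<phi>10 \<phi>11"
  shows "(\<forall>u v. D (sum_bracket br0 br1 u v) = sum_bracket br0 br1 (D u) v + sum_bracket br0 br1 u (D v))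
    \<longleftrightarrow> \<phi>00 \<in> lie_algebra.derivations s0 br0 \<and>
        range \<phi>01 \<subseteq> lie_algebra.center br0 \<and>
        lie_algebra.derived_algebra s0 br0 \<subseteq> {x. \<phi>10 x = 0}"
    (is "?Leibniz \<longleftrightarrow> ?blocks")
proof -
  interpret L0: lie_algebra s0 br0 by fact
  have zero: "\<phi>00 0 = 0" "\<phi>01 0 = 0" "\<phi>11 0 = 0"
    using assms(3,4,6) by (simp_all add: linear_zero)
  have "?Leibniz \<longleftrightarrow>
      (\<forall>x y x' y'. \<phi>00 (br0 x x') = br0 (\<phi>00 x + \<phi>01 y) x' + br0 x (\<phi>00 x' + \<phi>01 y')
         \<and> \<phi>10 (br0 x x') = 0)"
    by (simp add: D_def block_map_def sum_bracket_def assms(2) zero)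
  also have "\<dots> \<longleftrightarrow>
      (\<forall>x x'. \<phi>00 (br0 x x') = br0 (\<phi>00 x) x' + br0 x (\<phi>00 x')) \<and>
      (\<forall>y x'. br0 (\<phi>01 y) x' = 0) \<and> (\<forall>x x'. \<phi>10 (br0 x x') = 0)"
    (is "?split \<longleftrightarrow> ?L00 \<and> ?C01 \<and> ?K10")
  proof
    assume split: ?split
    have "\<phi>00 (br0 x x') = br0 (\<phi>00 x) x' + br0 x (\<phi>00 x')" for x x'
    proof -
      have "\<phi>00 (br0 x x') = br0 (\<phi>00 x + \<phi>01 0) x' + br0 x (\<phi>00 x' + \<phi>01 0)"
        using split by blast
      then show ?thesis
        by (simp add: zero)
    qed
    moreover have "br0 (\<phi>01 y) x' = 0" for y x'
    proof -
      have "\<phi>00 (br0 0 x') = br0 (\<phi>00 0 + \<phi>01 y) x' + br0 0 (\<phi>00 x' + \<phi>01 0)"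
        using split by blast
      then show ?thesis
        by (simp add: zero)
    qed
    ultimately show "?L00 \<and> ?C01 \<and> ?K10"
      using split by blast
  next
    assume blocks: "?L00 \<and> ?C01 \<and> ?K10"
    then have "\<phi>01 y \<in> L0.center" for y
      by (simp add: L0.center_def)
    then have "br0 x (\<phi>01 y) = 0" for x y
      by (rule L0.bracket_center_right)
    with blocks show ?split
      by (simp add: L0.bracket_add)
  qed
  also have "\<dots> \<longleftrightarrow> ?blocks"
    using assms(3) L0.derived_algebra_subset_kernel_iff[OF assms(5)]
    by (simp add: L0.derivations_def L0.center_def image_subset_iff)
  finally show ?thesis .
qed

theorem proposition11:
  fixes scale0 :: "'f::field \<Rightarrow> 'a::ab_group_add \<Rightarrow> 'a"
    and bracket0 :: "'a \<Rightarrow> 'a \<Rightarrow> 'a"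
    and scaleW :: "'f \<Rightarrow> 'b::ab_group_add \<Rightarrow> 'b"
    and bracketW :: "'b \<Rightarrow> 'b \<Rightarrow> 'b"
  assumes "lie_algebra scale0 bracket0"
    and "lie_algebra.almost_abelian scale0 bracket0"
    and "lie_algebra.indecomposable scale0 bracket0"
    and "lie_algebra scaleW bracketW"
    and "lie_algebra.abelian bracketW UNIV"
    and "lie_algebra.almost_abelian (module_prod.scale scale0 scaleW) (sum_bracket bracket0 bracketW)"
  shows "lie_algebra.derivations (module_prod.scale scale0 scaleW) (sum_bracket bracket0 bracketW) =
    {block_map \<phi>00 \<phi>01 \<phi>10 \<phi>11 | \<phi>00 \<phi>01 \<phi>10 \<phi>11.
       Vector_Spaces.linear scale0 scale0 \<phi>00 \<and> Vector_Spaces.linear scaleW scale0 \<phi>01 \<and>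
       Vector_Spaces.linear scale0 scaleW \<phi>10 \<and> Vector_Spaces.linear scaleW scaleW \<phi>11 \<and>
       \<phi>00 \<in> lie_algebra.derivations scale0 bracket0 \<and>
       range \<phi>01 \<subseteq> lie_algebra.center bracket0 \<and>
       lie_algebra.derived_algebra scale0 bracket0 \<subseteq> {x. \<phi>10 x = 0}}"
    (is "?Der = ?Blocks")
proof -
  note L0 = assms(1) and W = assms(4)
  interpret L0: lie_algebra scale0 bracket0 by (rule L0)
  interpret W: lie_algebra scaleW bracketW by (rule W)
  have ab: "bracketW y y' = 0" for y y'
    using assms(5) by (simp add: W.abelian_def W.commuting_def)
  note der = lie_algebra.derivations_def[OF lie_algebra_direct_sum[OF L0 W]]
  note Leibniz = block_map_Leibniz_iff[OF L0 ab]
  show ?thesis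
  proof
    show "?Der \<subseteq> ?Blocks"
    proof
      fix D assume D: "D \<in> ?Der"
      then have "Vector_Spaces.linear (module_prod.scale scale0 scaleW)
          (module_prod.scale scale0 scaleW) D"
        by (simp add: der)
      then obtain \<phi>00 \<phi>01 \<phi>10 \<phi>11 where block: "D = block_map \<phi>00 \<phi>01 \<phi>10 \<phi>11"
        and lin: "Vector_Spaces.linear scale0 scale0 \<phi>00" "Vector_Spaces.linear scaleW scale0 \<phi>01"
          "Vector_Spaces.linear scale0 scaleW \<phi>10" "Vector_Spaces.linear scaleW scaleW \<phi>11"
        by (rule linear_prod_eq_block_map[OF L0.vector_space_axioms W.vector_space_axioms])
      from D have Leibniz_D: "\<forall>u v. D (sum_bracket bracket0 bracketW u v) =
          sum_bracket bracket0 bracketW (D u) v + sum_bracket bracket0 bracketW u (D v)"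
        by (simp add: der)
      note blocks = Leibniz[OF lin, THEN iffD1, OF Leibniz_D[unfolded block]]
      show "D \<in> ?Blocks"
        unfolding mem_Collect_eq by (intro exI conjI, rule block) (use lin blocks in simp_all)
    qed
    show "?Blocks \<subseteq> ?Der"
    proof
      fix D assume "D \<in> ?Blocks"
      then obtain \<phi>00 \<phi>01 \<phi>10 \<phi>11 where block: "D = block_map \<phi>00 \<phi>01 \<phi>10 \<phi>11"
        and lin: "Vector_Spaces.linear scale0 scale0 \<phi>00" "Vector_Spaces.linear scaleW scale0 \<phi>01"
          "Vector_Spaces.linear scale0 scaleW \<phi>10" "Vector_Spaces.linear scaleW scaleW \<phi>11"
        and blocks: "\<phi>00 \<in> L0.derivations" "range \<phi>01 \<subseteq> L0.center"
          "L0.derived_algebra \<subseteq> {x. \<phi>10 x = 0}"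
        by blast
      have "\<forall>u v. D (sum_bracket bracket0 bracketW u v) =
          sum_bracket bracket0 bracketW (D u) v + sum_bracket bracket0 bracketW u (D v)"
        unfolding block by (intro Leibniz[OF lin, THEN iffD2] conjI blocks)
      then show "D \<in> ?Der"
        using linear_block_map[OF lin] by (simp add: der block)
    qed
  qed
qed

end
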